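(* Let $n\ge 2$ and $G_n=C_{2^n}\times C_{2^n}$ with orbit tree $T_n$. If $\chi\in G_n^*$ is a character not of highest order (i.e. of order less than $2^n$), then $\chi$ is the square $\psi^2$ of a character $\psi\in G_n^*$ of higher order. Moreover, if $\chi=\psi^2$ for characters $\chi,\psi\in G_n^*$, then for every node $M$ of $T_n$: $\chi(M)=|M|$ if and only if $\psi(M)=\pm|M|$; $\chi(M)=-|M|$ if and only if $M$ is a child of a node $X$ of $T_n$ with $\psi(X)=-|X|$; and $\chi(M)=0$ for all other nodes $M$. Here $\chi(M)=\sum_{g\in M}\chi(g)$.
   Context: $C_m=\{x/m: x\in\{0,\dots,m-1\}\}$ under addition mod $1$, and $G_n=C_{2^n}\times C_{2^n}$, with dual group $G_n^*$ of complex characters; $\psi^2$ denotes the pointwise square $g\mapsto\psi(g)^2$. The multiplier group $U(2^n)=\{u: u \text{ odd}, 1\le u\le 2^n\}$ acts on $G_n$ by $g\mapsto u\cdot g$. The orbit tree $T_n$ is the rooted tree whose nodes are the orbits of $G_n$ under this action: the root is $\{(0,0)\}$, the nodes at level $i$ are the orbits consisting of elements of order $2^i$ ($0\le i\le n$), and the parent of a node $M$ at level $i+1$ is the orbit containing $2x$ for any $x\in M$; the children of a node are the nodes whose parent it is. *)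

theory Defs
  imports Complex_Main "HOL-Algebra.Group_Action" "HOL-Algebra.Multiplicative_Group"
begin

section \<open>The groups\<close>

text \<open>\<open>frac\<close> is the fractional part, i.e. reduction modulo 1.\<close>

definition C_group :: "nat \<Rightarrow> rat monoid" where
  "C_group m = \<lparr>carrier = {of_nat x / of_nat m | x. x < m},
          monoid.mult = (\<lambda>a b. frac (a + b)), one = 0\<rparr>"

definition G_group :: "nat \<Rightarrow> (rat \<times> rat) monoid" where
  "G_group n = C_group (2 ^ n) \<times>\<times> C_group (2 ^ n)"

lemma comm_group_C_group:
  assumes "m > 0"
  shows "comm_group (C_group m)"
proof -
  have closed: "frac (a + b) \<in> carrier (C_group m)" if ab: "a \<in> carrier (C_group m)" "b \<in> carrier (C_group m)" for a b
  proof -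
    obtain x where x: "a = of_nat x / of_nat m"
      using ab(1) by (auto simp: C_group_def)
    obtain y where y: "b = of_nat y / of_nat m"
      using ab(2) by (auto simp: C_group_def)
    have eq: "a + b = of_nat (x + y) / of_nat m"
      by (simp add: x y add_divide_distrib)
    have "of_nat (x + y) = (of_nat ((x + y) mod m) :: rat) + of_nat m * of_nat ((x + y) div m)"
      by (metis mod_mult_div_eq of_nat_add of_nat_mult)
    then have "a + b = of_nat ((x + y) mod m) / of_nat m + of_int (int ((x + y) div m))"
      using assms by (simp add: eq field_simps)
    then have "frac (a + b) = frac (of_nat ((x + y) mod m) / (of_nat m :: rat))"
      by (simp only: frac_add_of_int_right)
    also have "\<dots> = of_nat ((x + y) mod m) / of_nat m"
      using assms by (subst frac_eq) simp
    finally show ?thesis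
      using assms by (auto simp: C_group_def)
  qed
  have fr: "frac a = a" if "a \<in> carrier (C_group m)" for a
    using that assms by (auto simp: C_group_def frac_eq)
  have fl: "frac (frac x + y) = frac (x + y)" for x y :: rat
    using frac_add_of_int_right[of "frac x + y" "floor x"] by (simp add: frac_def[of x] add_ac)
  show ?thesis
  proof (rule comm_groupI)
    fix x y assume "x \<in> carrier (C_group m)" "y \<in> carrier (C_group m)"
    then show "x \<otimes>\<^bsub>C_group m\<^esub> y \<in> carrier (C_group m)"
      using closed by (simp add: C_group_def)
  next
    show "\<one>\<^bsub>C_group m\<^esub> \<in> carrier (C_group m)"
      using assms by (auto simp: C_group_def intro: exI[of _ 0])
  next
    fix x y z
    show "x \<otimes>\<^bsub>C_group m\<^esub> y \<otimes>\<^bsub>C_group m\<^esub> z = x \<otimes>\<^bsub>C_group m\<^esub> (y \<otimes>\<^bsub>C_group m\<^esub> z)"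
      using fl[of "x + y" z] fl[of "y + z" x] by (simp add: C_group_def add_ac)
  next
    fix x y show "x \<otimes>\<^bsub>C_group m\<^esub> y = y \<otimes>\<^bsub>C_group m\<^esub> x"
      by (simp add: C_group_def add.commute)
  next
    fix x assume "x \<in> carrier (C_group m)"
    then show "\<one>\<^bsub>C_group m\<^esub> \<otimes>\<^bsub>C_group m\<^esub> x = x"
      using fr by (simp add: C_group_def)
  next
    fix x assume "x \<in> carrier (C_group m)"
    then obtain k where k: "x = of_nat k / of_nat m" "k < m"
      by (auto simp: C_group_def)
    show "\<exists>y\<in>carrier (C_group m). y \<otimes>\<^bsub>C_group m\<^esub> x = \<one>\<^bsub>C_group m\<^esub>"
    proof (cases "k = 0")
      case True
      then show ?thesis
        using k assms by (intro bexI[of _ 0]) (auto simp: C_group_def intro: exI[of _ 0])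
    next
      case False
      have "of_nat (m - k) / of_nat m + x = 1"
        using k assms by (simp add: of_nat_diff field_simps)
      then show ?thesis
        using k assms False
        by (intro bexI[of _ "of_nat (m - k) / of_nat m"])
           (auto simp: C_group_def simp del: of_nat_diff intro!: exI[of _ "m - k"])
    qed
  qed
qed

lemma comm_group_G_group: "comm_group (G_group n)"
proof -
  interpret A: comm_group "C_group (2 ^ n)"
    by (rule comm_group_C_group) simp
  have "group (G_group n)"
    unfolding G_group_def by (intro DirProd_group A.is_group)
  then show ?thesis
    by (rule group.group_comm_groupI) (auto simp: G_group_def A.m_comm)
qed

section \<open>Characters\<close>

definition complex_mult_group :: "complex monoid" where
  "complex_mult_group = \<lparr>carrier = - {0}, monoid.mult = (*), one = 1\<rparr>"

text \<open>Characters are extensional (they take the value \<open>undefined\<close> off the carrier), so that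
  equality of characters is equality of functions on the group.\<close>

definition dual_group :: "('a, 'b) monoid_scheme \<Rightarrow> ('a \<Rightarrow> complex) monoid" where
  "dual_group H = \<lparr>carrier = hom H complex_mult_group \<inter> extensional (carrier H),
     monoid.mult = (\<lambda>\<chi> \<psi>. \<lambda>g\<in>carrier H. \<chi> g * \<psi> g),
     one = (\<lambda>g\<in>carrier H. 1)\<rparr>"

lemma comm_group_dual_group:
  assumes "group H"
  shows "comm_group (dual_group H)"
proof -
  interpret group H by (fact assms)
  show ?thesis
  proof (rule comm_groupI)
    fix x assume "x \<in> carrier (dual_group H)"
    then show "\<exists>y\<in>carrier (dual_group H). y \<otimes>\<^bsub>dual_group H\<^esub> x = \<one>\<^bsub>dual_group H\<^esub>"
      by (intro bexI[of _ "\<lambda>g\<in>carrier H. inverse (x g)"])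
         (auto simp: dual_group_def hom_def complex_mult_group_def Pi_iff intro!: restrict_ext)
  next
    fix x assume "x \<in> carrier (dual_group H)"
    then show "\<one>\<^bsub>dual_group H\<^esub> \<otimes>\<^bsub>dual_group H\<^esub> x = x"
      by (auto simp: dual_group_def fun_eq_iff extensional_def)
  qed (auto simp: dual_group_def hom_def complex_mult_group_def Pi_iff intro!: restrict_ext)
qed

definition char_square :: "('a, 'b) monoid_scheme \<Rightarrow> ('a \<Rightarrow> complex) \<Rightarrow> 'a \<Rightarrow> complex" where
  "char_square H \<psi> = (\<lambda>g\<in>carrier H. \<psi> g ^ 2)"

definition char_sum :: "('a \<Rightarrow> complex) \<Rightarrow> 'a set \<Rightarrow> complex" where
  "char_sum \<chi> M = (\<Sum>g\<in>M. \<chi> g)"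

section \<open>The orbit tree\<close>

text \<open>For \<open>n \<ge> 1\<close> this is the group of units modulo \<open>2 ^ n\<close>.\<close>

definition U_group :: "nat \<Rightarrow> nat monoid" where
  "U_group n = \<lparr>carrier = {u. odd u \<and> 1 \<le> u \<and> u \<le> 2 ^ n},
          monoid.mult = (\<lambda>u v. (u * v) mod 2 ^ n), one = 1\<rparr>"

text \<open>\<open>G_group n\<close> is written multiplicatively in \<open>HOL-Algebra\<close>, so \<open>u \<cdot> g\<close> is \<open>g [^] u\<close>.\<close>

definition multiplier :: "nat \<Rightarrow> nat \<Rightarrow> rat \<times> rat \<Rightarrow> rat \<times> rat" where
  "multiplier n u = (\<lambda>g\<in>carrier (G_group n). g [^]\<^bsub>G_group n\<^esub> u)"

definition tree_nodes :: "nat \<Rightarrow> (rat \<times> rat) set set" where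
  "tree_nodes n = orbits (U_group n) (carrier (G_group n)) (multiplier n)"

definition tree_level :: "nat \<Rightarrow> nat \<Rightarrow> (rat \<times> rat) set set" where
  "tree_level n i = {M \<in> tree_nodes n. \<forall>x\<in>M. group.ord (G_group n) x = 2 ^ i}"

text \<open>Only nodes at positive level are children; without this restriction the root would be
  its own child.\<close>

definition is_child :: "nat \<Rightarrow> (rat \<times> rat) set \<Rightarrow> (rat \<times> rat) set \<Rightarrow> bool" where
  "is_child n M X \<longleftrightarrow>
     (\<exists>i. M \<in> tree_level n (Suc i)) \<and> X \<in> tree_nodes n \<and> (\<forall>x\<in>M. x [^]\<^bsub>G_group n\<^esub> (2::nat) \<in> X)"

end

theory Submission
  imports Defs "HOL-Number_Theory.Cong"
begin

text \<open>On the orbit \<open>M\<close> of \<open>g\<close>, which consists of the odd powers of \<open>g\<close>, a character \<open>\<chi>\<close> is the constant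
  \<open>\<chi> g\<close> if \<open>\<chi> g = 1\<close> or \<open>\<chi> g = -1\<close>. Otherwise \<open>\<chi> g\<close> has order \<open>2 ^ (j + 1)\<close> with \<open>j \<ge> 1\<close>, and the power map with exponent
  \<open>2 ^ j + 1\<close> permutes \<open>M\<close> and negates \<open>\<chi>\<close>, so the sum vanishes. Hence everything is decided by the
  value \<open>\<chi> g = \<psi> g ^ 2 = \<psi> (g ^ 2)\<close>. A square root of \<open>\<chi>\<close> is obtained from square roots of its values on the
  two generators; choosing the first root different from 1 makes \<open>\<psi>\<close> nontrivial, so its order is twice
  that of \<open>\<chi>\<close> even when \<open>\<chi> = 1\<close>.\<close>

section \<open>Values of a character on the identity and on powers\<close>

lemma hom_complex_mult_one:
  fixes G (structure)
  assumes "group G" "\<chi> \<in> hom G complex_mult_group"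
  shows "\<chi> \<one>\<^bsub>G\<^esub> = 1"
proof -
  interpret group G by fact
  have "\<chi> \<one> \<in> carrier complex_mult_group"
    using assms(2) one_closed by (rule hom_in_carrier)
  moreover have "\<chi> (\<one> \<otimes> \<one>) = \<chi> \<one> * \<chi> \<one>"
    using hom_mult[OF assms(2) one_closed one_closed] by (simp add: complex_mult_group_def)
  ultimately show ?thesis by (simp add: complex_mult_group_def)
qed

lemma hom_complex_mult_pow:
  fixes G (structure)
  assumes "group G" "\<chi> \<in> hom G complex_mult_group" "x \<in> carrier G"
  shows "\<chi> (x [^]\<^bsub>G\<^esub> (k::nat)) = \<chi> x ^ k"
proof -
  interpret group G by fact
  show ?thesis
  proof (induction k)
    case 0
    then show ?case using hom_complex_mult_one[OF assms(1,2)] by simp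
  next
    case (Suc k)
    have "\<chi> (x [^] k \<otimes> x) = \<chi> (x [^] k) * \<chi> x"
      using assms(2,3) unfolding hom_def complex_mult_group_def by simp
    then show ?case using Suc by simp
  qed
qed

section \<open>Sums of a character over the odd powers of an element\<close>

text \<open>If \<open>k\<close> is least with \<open>z ^ 2 ^ k = 1\<close>, then halving that
  exponent gives a square root of 1 other than 1, hence -1. One further factor \<open>z\<close>
  turns this into \<open>- z\<close>, and \<open>z \<noteq> - 1\<close> forces
  \<open>k \<ge> 2\<close>, which makes the exponent odd.\<close>

lemma odd_power_minus_one_shift:
  fixes z :: complex
  assumes "z ^ 2 ^ n = 1" "z \<noteq> 1" "z \<noteq> - 1"
  obtains v :: nat where "odd v" "z ^ v = - z"
proof -
  define k where "k = (LEAST k. z ^ 2 ^ k = 1)"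
  have k: "z ^ 2 ^ k = 1"
    unfolding k_def using assms(1) by (rule LeastI)
  have "k \<noteq> 0"
    using k assms(2) by (intro notI) simp
  then obtain j where j: "k = Suc j"
    by (cases k) auto
  have "z ^ 2 ^ j \<noteq> 1"
    using not_less_Least[of j "\<lambda>k. z ^ 2 ^ k = 1"] j k_def by auto
  moreover have "(z ^ 2 ^ j) ^ 2 = 1"
    using k j by (simp add: power_mult [symmetric] mult.commute)
  ultimately have zj: "z ^ 2 ^ j = - 1"
    by (simp add: power2_eq_1_iff)
  then have "j \<noteq> 0"
    using assms(3) by (intro notI) simp
  then have "odd (2 ^ j + 1 :: nat)" by simp
  moreover have "z ^ (2 ^ j + 1) = - z"
    using zj by (simp add: power_add)
  ultimately show ?thesis using that by blast
qed

text \<open>An odd \<open>v\<close> is a unit modulo \<open>2 ^ n\<close>; raising to an inverse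
  \<open>w\<close> of it undoes the power map.\<close>

lemma (in group) odd_pow_inj:
  assumes "\<And>x. x \<in> carrier G \<Longrightarrow> x [^] ((2::nat) ^ n) = \<one>" "odd (v::nat)"
  shows "inj_on (\<lambda>x. x [^] v) (carrier G)"
proof -
  have "coprime v (2 ^ n)" using assms(2) by simp
  then obtain w where "[v * w = 1] (mod 2 ^ n)"
    using cong_solve_coprime_nat by fastforce
  then have w: "x [^] (v * w) = x" if "x \<in> carrier G" for x
  proof -
    \<comment> \<open>The congruence is moved to the integers, where \<open>v * w - 1\<close> is not
      truncated and two powers of \<open>x\<close> agree exactly if \<open>ord x\<close> divides the
      difference of the exponents.\<close>
    have "int (ord x) dvd int (2 ^ n)"
      using assms(1)[OF that] that by (simp only: int_dvd_int_iff pow_eq_id)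
    moreover have "int (2 ^ n) dvd int (v * w) - int 1"
      using \<open>[v * w = 1] (mod 2 ^ n)\<close> by (simp only: cong_int_iff[symmetric] cong_iff_dvd_diff)
    ultimately have "int (ord x) dvd int (v * w) - int 1"
      by (rule dvd_trans)
    then have "x [^] int (v * w) = x [^] int 1"
      using int_pow_eq[OF that] by (metis dvd_minus_iff minus_diff_eq)
    then show ?thesis using that by (simp only: int_pow_int nat_pow_eone)
  qed
  show ?thesis
    by (rule inj_on_inverseI[where g = "\<lambda>x. x [^] w"]) (simp add: nat_pow_pow w)
qed

text \<open>Odd powers of 1 and of -1 are the number itself, so in these two cases
  \<open>\<chi>\<close> is constant on \<open>M\<close>. In all others, reindexing the sum along a
  suitable odd power map reverses its sign.\<close>

lemma char_sum_odd_powers: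
  fixes G (structure)
  assumes G: "group G" "finite (carrier G)" "\<And>x. x \<in> carrier G \<Longrightarrow> x [^] ((2::nat) ^ n) = \<one>"
    and chi: "\<chi> \<in> hom G complex_mult_group" and g: "g \<in> carrier G"
    and M: "M = {g [^] k | k::nat. odd k}"
  shows "char_sum \<chi> M = (if \<chi> g = 1 then of_nat (card M)
    else if \<chi> g = - 1 then - of_nat (card M) else 0)"
proof -
  interpret group G by fact
  note pow = hom_complex_mult_pow[OF G(1) chi]
  have sub: "M \<subseteq> carrier G" using M g by auto
  show ?thesis
  proof (cases "\<chi> g = 1 \<or> \<chi> g = - 1")
    case True
    then have "\<chi> x = \<chi> g" if "x \<in> M" for x
      using that pow[OF g] by (auto simp: M)
    then have "char_sum \<chi> M = of_nat (card M) * \<chi> g"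
      unfolding char_sum_def by simp
    then show ?thesis using True by auto
  next
    case False
    have "\<chi> g ^ 2 ^ n = 1"
      using pow[OF g, of "2 ^ n"] hom_complex_mult_one[OF G(1) chi] G(3)[OF g] by simp
    then obtain v where v: "odd v" "\<chi> g ^ v = - \<chi> g"
      using odd_power_minus_one_shift False by blast
    have inj: "inj_on (\<lambda>x. x [^] v) M"
      using odd_pow_inj[OF G(3) v(1)] sub by (rule inj_on_subset)
    have "(\<lambda>x. x [^] v) ` M \<subseteq> M"
    proof
      fix y assume "y \<in> (\<lambda>x. x [^] v) ` M"
      then obtain k where "odd k" "y = g [^] (k * v)"
        using M g by (auto simp: nat_pow_pow)
      then show "y \<in> M" using M v(1) by (auto intro!: exI[of _ "k * v"])
    qed
    \<comment> \<open>\<open>M\<close> is finite, so an injective map of \<open>M\<close> into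
      itself is onto.\<close>
    then have "bij_betw (\<lambda>x. x [^] v) M M"
      using inj endo_inj_surj[OF finite_subset[OF sub G(2)]] by (simp add: bij_betw_def)
    then have "char_sum \<chi> M = (\<Sum>x\<in>M. \<chi> (x [^] v))"
      unfolding char_sum_def by (rule sum.reindex_bij_betw[symmetric])
    also have "\<dots> = (\<Sum>x\<in>M. - \<chi> x)"
    proof (rule sum.cong)
      fix x assume "x \<in> M"
      then obtain k :: nat where k: "odd k" "x = g [^] k" using M by blast
      have "\<chi> (x [^] v) = (\<chi> g ^ v) ^ k"
        using k g pow by (simp add: nat_pow_pow power_mult[symmetric] mult.commute)
      \<comment> \<open>The sign comes out of \<open>(- \<chi> g) ^ k\<close> because
        \<open>k\<close> is odd.\<close>
      then show "\<chi> (x [^] v) = - \<chi> x" using k v pow[OF g] by simp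
    qed simp
    finally have "char_sum \<chi> M = - char_sum \<chi> M"
      by (simp add: char_sum_def sum_negf)
    then show ?thesis using False by simp
  qed
qed

section \<open>Arithmetic in \<open>C_group m\<close> and \<open>G_group n\<close>\<close>

lemma finite_G_group: "finite (carrier (G_group n))"
proof -
  have "finite (carrier (C_group m))" for m
    by (simp add: C_group_def)
  then show ?thesis by (simp add: G_group_def)
qed

lemma one_C_group: "\<one>\<^bsub>C_group m\<^esub> = 0"
  by (simp add: C_group_def)

lemma C_group_mult:
  assumes "m > 0"
  shows "(of_nat x / of_nat m) \<otimes>\<^bsub>C_group m\<^esub> (of_nat y / of_nat m) = of_nat ((x + y) mod m) / of_nat m"
proof -
  \<comment> \<open>Division of \<open>x + y\<close> by \<open>m\<close> with remainder splits off
    an integer, which \<open>frac\<close> discards.\<close>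
  have "(of_nat x / of_nat m + of_nat y / of_nat m :: rat)
      = of_nat ((x + y) mod m + m * ((x + y) div m)) / of_nat m"
    unfolding mod_mult_div_eq by (simp add: add_divide_distrib)
  also have "\<dots> = of_nat ((x + y) mod m) / of_nat m + of_int (int ((x + y) div m))"
    unfolding of_nat_add of_nat_mult using assms by (simp add: add_divide_distrib)
  finally have "frac (of_nat x / of_nat m + of_nat y / of_nat m :: rat)
      = frac (of_nat ((x + y) mod m) / of_nat m)"
    by (simp only: frac_add_of_int_right)
  also have "\<dots> = of_nat ((x + y) mod m) / of_nat m"
    using assms by (subst frac_eq) simp
  finally show ?thesis by (simp add: C_group_def)
qed

lemma C_group_pow:
  assumes "m > 0"
  shows "(of_nat x / of_nat m) [^]\<^bsub>C_group m\<^esub> (k::nat) = of_nat (k * x mod m) / of_nat m"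
proof -
  interpret comm_group "C_group m" by (rule comm_group_C_group) fact
  show ?thesis
  proof (induction k)
    case 0
    then show ?case by (simp add: C_group_def)
  next
    case (Suc k)
    then show ?case
      using C_group_mult[OF assms, of "k * x mod m" x] by (simp add: mod_add_right_eq add.commute)
  qed
qed

lemma G_group_pow:
  "p [^]\<^bsub>G_group n\<^esub> (k::nat) = (fst p [^]\<^bsub>C_group (2 ^ n)\<^esub> k, snd p [^]\<^bsub>C_group (2 ^ n)\<^esub> k)"
  by (induction k) (auto simp: G_group_def DirProd_def nat_pow_def split: prod.splits)

lemma G_group_exponent:
  assumes "p \<in> carrier (G_group n)"
  shows "p [^]\<^bsub>G_group n\<^esub> ((2::nat) ^ n) = \<one>\<^bsub>G_group n\<^esub>"
proof -
  have "a [^]\<^bsub>C_group m\<^esub> m = 0" if "a \<in> carrier (C_group m)" for a m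
  proof -
    obtain x where "x < m" "a = of_nat x / of_nat m"
      using \<open>a \<in> carrier (C_group m)\<close> by (auto simp: C_group_def)
    then show ?thesis using C_group_pow[of m x m] by simp
  qed
  then show ?thesis
    using assms unfolding G_group_pow by (auto simp: G_group_def one_C_group)
qed

section \<open>Nodes of the orbit tree as sets of odd powers\<close>

lemma orbit_multiplier:
  assumes "n \<ge> 1" and g: "g \<in> carrier (G_group n)"
  shows "orbit (U_group n) (multiplier n) g = {g [^]\<^bsub>G_group n\<^esub> k | k::nat. odd k}"
proof -
  interpret comm_group "G_group n" by (rule comm_group_G_group)
  have "\<exists>u. g [^]\<^bsub>G_group n\<^esub> k = g [^]\<^bsub>G_group n\<^esub> u \<and> odd u \<and> Suc 0 \<le> u \<and> u \<le> 2 ^ n" if "odd k" for k :: nat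
  proof (intro exI conjI)
    let ?u = "k mod 2 ^ n"
    have "g [^]\<^bsub>G_group n\<^esub> k = g [^]\<^bsub>G_group n\<^esub> (2 ^ n * (k div 2 ^ n) + ?u)" by simp
    also have "\<dots> = g [^]\<^bsub>G_group n\<^esub> ?u"
      using g G_group_exponent[OF g]
      by (simp only: nat_pow_mult[symmetric] nat_pow_pow[symmetric]) simp
    finally show "g [^]\<^bsub>G_group n\<^esub> k = g [^]\<^bsub>G_group n\<^esub> ?u" .
    \<comment> \<open>Reduction keeps the parity because \<open>2 ^ n\<close> is even for
      \<open>n \<ge> 1\<close>; an odd residue is then also nonzero.\<close>
    show "odd ?u" using that assms(1) by (simp add: dvd_mod_iff)
    then show "Suc 0 \<le> ?u" by (cases ?u) auto
    show "?u \<le> 2 ^ n" by (simp add: less_imp_le)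
  qed
  then show ?thesis
    using g by (auto simp: orbit_def U_group_def multiplier_def)
qed

lemma in_tree_nodes_iff:
  assumes "n \<ge> 1"
  shows "M \<in> tree_nodes n \<longleftrightarrow>
    (\<exists>g\<in>carrier (G_group n). M = {g [^]\<^bsub>G_group n\<^esub> k | k::nat. odd k})"
proof -
  have "M \<in> tree_nodes n \<longleftrightarrow>
      (\<exists>g\<in>carrier (G_group n). M = orbit (U_group n) (multiplier n) g)"
    unfolding tree_nodes_def orbits_def by blast
  then show ?thesis
    using orbit_multiplier[OF assms] by (simp cong: bex_cong)
qed

text \<open>The order of \<open>g\<close> is a power of 2 other than 1, and an exponent coprime to
  the order leaves it unchanged. This supplies the positive level that \<open>is_child\<close>
  demands.\<close>

lemma odd_powers_in_tree_level:
  assumes "n \<ge> 1" and g: "g \<in> carrier (G_group n)" "g \<noteq> \<one>\<^bsub>G_group n\<^esub>"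
  shows "\<exists>i. {g [^]\<^bsub>G_group n\<^esub> k | k::nat. odd k} \<in> tree_level n (Suc i)"
proof -
  interpret comm_group "G_group n" by (rule comm_group_G_group)
  have "ord g dvd 2 ^ n"
    using G_group_exponent[OF g(1)] g(1) by (simp add: pow_eq_id)
  then obtain j where j: "ord g = 2 ^ j"
    by (auto simp: divides_primepow_nat)
  then obtain i where i: "j = Suc i"
    using ord_eq_1[OF g(1)] g(2) by (cases j) auto
  have "ord (g [^]\<^bsub>G_group n\<^esub> k) = ord g" if "odd k" for k :: nat
    using that j pow_ord_eq_ord_iff[OF finite_G_group g(1)] by simp
  then show ?thesis
    using j i assms in_tree_nodes_iff by (auto simp: tree_level_def)
qed

section \<open>Character sums on nodes and the parent relation\<close>

text \<open>A node is finite and nonempty, so the possible sums \<open>card M\<close>,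
  \<open>- card M\<close> and 0 are distinct, and the sum tells which case \<open>\<chi> g\<close>
  is in.\<close>

lemma node_char_sum:
  assumes chi: "\<chi> \<in> hom (G_group n) complex_mult_group" and g: "g \<in> carrier (G_group n)"
    and M: "M = {g [^]\<^bsub>G_group n\<^esub> k | k::nat. odd k}"
  shows "char_sum \<chi> M = of_nat (card M) \<longleftrightarrow> \<chi> g = 1"
    and "char_sum \<chi> M = - of_nat (card M) \<longleftrightarrow> \<chi> g = - 1"
    and "\<chi> g \<noteq> 1 \<Longrightarrow> \<chi> g \<noteq> - 1 \<Longrightarrow> char_sum \<chi> M = 0"
proof -
  interpret comm_group "G_group n" by (rule comm_group_G_group)
  have "M \<subseteq> carrier (G_group n)" "g [^]\<^bsub>G_group n\<^esub> (1::nat) \<in> M"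
    using M g odd_one by blast+
  then have "card M \<noteq> 0"
    using finite_subset[OF _ finite_G_group] by (auto simp: card_eq_0_iff)
  moreover have "char_sum \<chi> M = (if \<chi> g = 1 then of_nat (card M)
      else if \<chi> g = - 1 then - of_nat (card M) else 0)"
    by (rule char_sum_odd_powers[OF is_group finite_G_group G_group_exponent chi g M])
  ultimately show "char_sum \<chi> M = of_nat (card M) \<longleftrightarrow> \<chi> g = 1"
    and "char_sum \<chi> M = - of_nat (card M) \<longleftrightarrow> \<chi> g = - 1"
    and "\<chi> g \<noteq> 1 \<Longrightarrow> \<chi> g \<noteq> - 1 \<Longrightarrow> char_sum \<chi> M = 0"
    by auto
qed

text \<open>The link is \<open>\<psi> g ^ 2 = \<psi> (g ^ 2)\<close>: the square of \<open>g\<close>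
  lies in the parent of \<open>M\<close>, and the sum over the parent is the negative of its size
  exactly if \<open>\<psi>\<close> is -1 there.\<close>

lemma power2_eq_minus_one_iff_child:
  assumes n: "n \<ge> 1" and g: "g \<in> carrier (G_group n)"
    and psi: "\<psi> \<in> hom (G_group n) complex_mult_group"
    and M: "M = {g [^]\<^bsub>G_group n\<^esub> k | k::nat. odd k}"
  shows "\<psi> g ^ 2 = - 1 \<longleftrightarrow>
    (\<exists>X \<in> tree_nodes n. is_child n M X \<and> char_sum \<psi> X = - of_nat (card X))"
proof -
  interpret comm_group "G_group n" by (rule comm_group_G_group)
  note pow = hom_complex_mult_pow[OF is_group psi]
  show ?thesis
  proof
    assume eq: "\<psi> g ^ 2 = - 1"
    define h where "h = g [^]\<^bsub>G_group n\<^esub> (2::nat)"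
    define X where "X = {h [^]\<^bsub>G_group n\<^esub> k | k::nat. odd k}"
    have h: "h \<in> carrier (G_group n)" using g by (simp add: h_def)
    \<comment> \<open>Since \<open>\<psi>\<close> is 1 at the identity, \<open>M\<close> is not the
      root and so can be a child.\<close>
    have "g \<noteq> \<one>\<^bsub>G_group n\<^esub>"
      using eq hom_complex_mult_one[OF is_group psi] by auto
    then have "\<exists>i. M \<in> tree_level n (Suc i)"
      unfolding M by (rule odd_powers_in_tree_level[OF n g])
    moreover have X: "X \<in> tree_nodes n"
      unfolding X_def in_tree_nodes_iff[OF n] using h by blast
    moreover have "x [^]\<^bsub>G_group n\<^esub> (2::nat) \<in> X" if "x \<in> M" for x
    proof -
      obtain k :: nat where "odd k" "x = g [^]\<^bsub>G_group n\<^esub> k"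
        using \<open>x \<in> M\<close> unfolding M by blast
      moreover from this have "x [^]\<^bsub>G_group n\<^esub> (2::nat) = h [^]\<^bsub>G_group n\<^esub> k"
        using g by (simp add: h_def nat_pow_pow mult.commute)
      ultimately show ?thesis unfolding X_def by blast
    qed
    moreover have "\<psi> h = - 1" using eq pow[OF g] by (simp add: h_def)
    then have "char_sum \<psi> X = - of_nat (card X)"
      using node_char_sum(2)[OF psi h X_def] by simp
    ultimately show "\<exists>X \<in> tree_nodes n. is_child n M X \<and> char_sum \<psi> X = - of_nat (card X)"
      unfolding is_child_def by blast
  next
    assume "\<exists>X \<in> tree_nodes n. is_child n M X \<and> char_sum \<psi> X = - of_nat (card X)"
    then obtain X where X: "X \<in> tree_nodes n" "is_child n M X" "char_sum \<psi> X = - of_nat (card X)"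
      by blast
    obtain h where h: "h \<in> carrier (G_group n)" "X = {h [^]\<^bsub>G_group n\<^esub> k | k::nat. odd k}"
      using X(1) in_tree_nodes_iff[OF n] by blast
    have "\<psi> h = - 1" using node_char_sum(2)[OF psi h] X(3) by simp
    have "g [^]\<^bsub>G_group n\<^esub> (1::nat) \<in> M" unfolding M using odd_one by blast
    then have "g [^]\<^bsub>G_group n\<^esub> (2::nat) \<in> X"
      using X(2) g by (simp add: is_child_def)
    then obtain k :: nat where "odd k" "g [^]\<^bsub>G_group n\<^esub> (2::nat) = h [^]\<^bsub>G_group n\<^esub> k"
      using h(2) by blast
    \<comment> \<open>The square of \<open>g\<close> is an odd power of the representative
      \<open>h\<close>, and odd powers of -1 are -1.\<close>
    then show "\<psi> g ^ 2 = - 1"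
      using pow[OF g, of 2] pow[OF h(1), of k] \<open>\<psi> h = - 1\<close> by simp
  qed
qed

section \<open>Powers and orders in the dual group\<close>

lemma dual_group_pow:
  assumes "group H" "\<chi> \<in> carrier (dual_group H)"
  shows "\<chi> [^]\<^bsub>dual_group H\<^esub> (k::nat) = (\<lambda>g\<in>carrier H. \<chi> g ^ k)"
proof -
  interpret comm_group "dual_group H" by (rule comm_group_dual_group) fact
  show ?thesis
  proof (induction k)
    case 0
    then show ?case by (simp add: dual_group_def)
  next
    case (Suc k)
    then show ?case by (simp add: dual_group_def mult.commute fun_eq_iff)
  qed
qed

text \<open>All character values are \<open>2 ^ n\<close>-th roots of unity because
  \<open>2 ^ n\<close> annihilates the group; hence the order of \<open>\<chi>\<close> divides
  \<open>2 ^ n\<close>.\<close>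

lemma ord_dual_G_group:
  assumes "\<chi> \<in> carrier (dual_group (G_group n))"
  obtains j where "group.ord (dual_group (G_group n)) \<chi> = 2 ^ j" "j \<le> n"
proof -
  interpret G: comm_group "G_group n" by (rule comm_group_G_group)
  interpret D: comm_group "dual_group (G_group n)" by (rule comm_group_dual_group) (rule G.is_group)
  have chi: "\<chi> \<in> hom (G_group n) complex_mult_group"
    using assms by (simp add: dual_group_def)
  have "\<chi> [^]\<^bsub>dual_group (G_group n)\<^esub> ((2::nat) ^ n) = \<one>\<^bsub>dual_group (G_group n)\<^esub>"
    unfolding dual_group_pow[OF G.is_group assms]
    by (auto simp: dual_group_def G_group_exponent hom_complex_mult_one[OF G.is_group chi]
        simp flip: hom_complex_mult_pow[OF G.is_group chi] intro!: restrict_ext)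
  then have "D.ord \<chi> dvd 2 ^ n"
    using assms by (simp add: D.pow_eq_id)
  then show ?thesis
    using that by (auto simp: divides_primepow_nat)
qed

section \<open>Characters and their values on two generators\<close>

lemma power_mod_period:
  fixes a :: complex
  assumes "a ^ N = 1"
  shows "a ^ (k mod N) = a ^ k"
proof -
  have "a ^ k = a ^ (N * (k div N) + k mod N)" by simp
  then show ?thesis using assms by (simp only: power_add power_mult) simp
qed

lemma G_group_cases:
  assumes "p \<in> carrier (G_group n)"
  obtains x y where "x < 2 ^ n" "y < 2 ^ n" "p = (of_nat x / of_nat (2 ^ n), of_nat y / of_nat (2 ^ n))"
  using assms by (auto simp: G_group_def C_group_def)

lemma G_group_carrierI:
  "x < 2 ^ n \<Longrightarrow> y < 2 ^ n \<Longrightarrow>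
    (of_nat x / of_nat (2 ^ n), of_nat y / of_nat (2 ^ n)) \<in> carrier (G_group n)"
  unfolding G_group_def C_group_def by auto

text \<open>Two \<open>2 ^ n\<close>-th roots of unity can be prescribed freely on the generators:
  reducing an exponent modulo \<open>2 ^ n\<close> does not change their powers, so the product
  formula is multiplicative.\<close>

lemma character_of_roots:
  assumes a: "a ^ 2 ^ n = 1" and b: "b ^ 2 ^ n = 1"
  obtains \<psi> where "\<psi> \<in> carrier (dual_group (G_group n))"
    "\<And>x y. x < 2 ^ n \<Longrightarrow> y < 2 ^ n \<Longrightarrow>
      \<psi> (of_nat x / of_nat (2 ^ n), of_nat y / of_nat (2 ^ n)) = a ^ x * b ^ y"
proof -
  define N :: nat where "N = 2 ^ n"
  have N: "N > 0" by (simp add: N_def)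
  \<comment> \<open>Multiplying a coordinate by \<open>N\<close> recovers its numerator, and
    \<open>nat\<close> with the floor turns it into an exponent.\<close>
  define \<psi> where "\<psi> = (\<lambda>p\<in>carrier (G_group n).
    a ^ nat \<lfloor>of_nat N * fst p\<rfloor> * b ^ nat \<lfloor>of_nat N * snd p\<rfloor>)"
  have val: "\<psi> (of_nat x / of_nat N, of_nat y / of_nat N) = a ^ x * b ^ y" if "x < N" "y < N" for x y
    using that N G_group_carrierI[of x n y] by (simp add: \<psi>_def N_def)
  have nz: "a \<noteq> 0" "b \<noteq> 0" using a b by (auto simp: power_0_left)
  have "\<psi> \<in> hom (G_group n) complex_mult_group"
  proof (rule homI)
    fix p assume "p \<in> carrier (G_group n)"
    then show "\<psi> p \<in> carrier complex_mult_group"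
      using nz by (simp add: \<psi>_def complex_mult_group_def)
  next
    fix p q assume "p \<in> carrier (G_group n)" "q \<in> carrier (G_group n)"
    then obtain x y x' y' where p: "x < N" "y < N" "p = (of_nat x / of_nat N, of_nat y / of_nat N)"
      and q: "x' < N" "y' < N" "q = (of_nat x' / of_nat N, of_nat y' / of_nat N)"
      unfolding N_def by (metis G_group_cases)
    have "p \<otimes>\<^bsub>G_group n\<^esub> q = (of_nat ((x + x') mod N) / of_nat N, of_nat ((y + y') mod N) / of_nat N)"
      unfolding p q using C_group_mult[OF N] by (simp add: G_group_def N_def)
    then have "\<psi> (p \<otimes>\<^bsub>G_group n\<^esub> q) = a ^ ((x + x') mod N) * b ^ ((y + y') mod N)"
      using val N by simp
    also have "\<dots> = a ^ (x + x') * b ^ (y + y')"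
      using a b by (simp add: power_mod_period N_def)
    finally show "\<psi> (p \<otimes>\<^bsub>G_group n\<^esub> q) = \<psi> p \<otimes>\<^bsub>complex_mult_group\<^esub> \<psi> q"
      using p q val by (simp add: complex_mult_group_def power_add)
  qed
  then have "\<psi> \<in> carrier (dual_group (G_group n))"
    by (simp add: dual_group_def \<psi>_def)
  then show ?thesis using that val N_def by blast
qed

text \<open>The point \<open>(x / 2 ^ n, y / 2 ^ n)\<close> is the \<open>x\<close>-th power of the
  first generator times the \<open>y\<close>-th power of the second. Zeros and ones are written with
  \<open>of_nat\<close> to match the shape in which carrier elements are given.\<close>

lemma character_on_generators:
  assumes chi: "\<chi> \<in> hom (G_group n) complex_mult_group" and "n \<ge> 1" "x < 2 ^ n" "y < 2 ^ n"
  shows "\<chi> (of_nat x / of_nat (2 ^ n), of_nat y / of_nat (2 ^ n)) =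
    \<chi> (of_nat 1 / of_nat (2 ^ n), of_nat 0 / of_nat (2 ^ n)) ^ x *
    \<chi> (of_nat 0 / of_nat (2 ^ n), of_nat 1 / of_nat (2 ^ n)) ^ y"
    (is "\<chi> ?p = \<chi> ?e ^ x * \<chi> ?f ^ y")
proof -
  interpret comm_group "G_group n" by (rule comm_group_G_group)
  define N :: nat where "N = 2 ^ n"
  have N: "N > 1" using assms(2) one_less_power[of "2::nat" n] by (simp add: N_def)
  have e: "?e \<in> carrier (G_group n)" "?f \<in> carrier (G_group n)"
    using N by (auto simp only: N_def intro!: G_group_carrierI)
  have "?e [^]\<^bsub>G_group n\<^esub> x = (of_nat x / of_nat N, of_nat 0 / of_nat N)"
    "?f [^]\<^bsub>G_group n\<^esub> y = (of_nat 0 / of_nat N, of_nat y / of_nat N)"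
    using N C_group_pow[of N 0] C_group_pow[of N 1] assms(3,4)
    unfolding G_group_pow by (simp_all add: N_def)
  then have "?e [^]\<^bsub>G_group n\<^esub> x \<otimes>\<^bsub>G_group n\<^esub> ?f [^]\<^bsub>G_group n\<^esub> y = ?p"
    using N C_group_mult[of N x 0] C_group_mult[of N 0 y] assms(3,4)
    by (simp add: G_group_def N_def)
  moreover have "\<chi> (?e [^]\<^bsub>G_group n\<^esub> x \<otimes>\<^bsub>G_group n\<^esub> ?f [^]\<^bsub>G_group n\<^esub> y) =
      \<chi> (?e [^]\<^bsub>G_group n\<^esub> x) * \<chi> (?f [^]\<^bsub>G_group n\<^esub> y)"
    using chi e by (simp add: hom_def complex_mult_group_def del: of_nat_0 of_nat_1 of_nat_power)
  ultimately show ?thesis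
    using hom_complex_mult_pow[OF is_group chi] e by simp
qed

section \<open>Square roots of characters\<close>

text \<open>The order bound makes all values of \<open>\<chi>\<close> roots of unity of exponent
  \<open>2 ^ (n - 1)\<close>, so their complex square roots have exponent \<open>2 ^ n\<close> and
  are admissible values on the generators.\<close>

lemma exists_nontrivial_char_square_root:
  assumes n: "n \<ge> 1" and chi: "\<chi> \<in> carrier (dual_group (G_group n))"
    and ord: "group.ord (dual_group (G_group n)) \<chi> < 2 ^ n"
  obtains \<psi> where "\<psi> \<in> carrier (dual_group (G_group n))" "\<chi> = char_square (G_group n) \<psi>"
    "\<psi> \<noteq> \<one>\<^bsub>dual_group (G_group n)\<^esub>"
proof -
  interpret G: comm_group "G_group n" by (rule comm_group_G_group)
  interpret D: comm_group "dual_group (G_group n)" by (rule comm_group_dual_group) (rule G.is_group)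
  have chi': "\<chi> \<in> hom (G_group n) complex_mult_group"
    using chi by (simp add: dual_group_def)
  define e where "e = (of_nat 1 / of_nat (2 ^ n) :: rat, of_nat 0 / of_nat (2 ^ n) :: rat)"
  define f where "f = (of_nat 0 / of_nat (2 ^ n) :: rat, of_nat 1 / of_nat (2 ^ n) :: rat)"
  have N: "(1::nat) < 2 ^ n" "(0::nat) < 2 ^ n" using n one_less_power[of "2::nat" n] by auto
  have ef: "e \<in> carrier (G_group n)" "f \<in> carrier (G_group n)"
    unfolding e_def f_def using N by (auto simp only: intro!: G_group_carrierI)
  obtain j where j: "D.ord \<chi> = 2 ^ j"
    using ord_dual_G_group[OF chi] by blast
  \<comment> \<open>A power of 2 strictly below \<open>2 ^ n\<close> divides
    \<open>2 ^ (n - 1)\<close>.\<close>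
  then have "j \<le> n - 1" using ord by simp
  then have "D.ord \<chi> dvd 2 ^ (n - 1)"
    unfolding j by (rule le_imp_power_dvd)
  then have *: "\<chi> [^]\<^bsub>dual_group (G_group n)\<^esub> ((2::nat) ^ (n - 1)) = \<one>\<^bsub>dual_group (G_group n)\<^esub>"
    using chi by (simp add: D.pow_eq_id)
  then have half: "\<chi> g ^ 2 ^ (n - 1) = 1" if "g \<in> carrier (G_group n)" for g
    using fun_cong[of _ _ g, OF *[unfolded dual_group_pow[OF G.is_group chi]]] that
    by (simp add: dual_group_def)
  have root: "c ^ 2 ^ n = 1" if "c ^ 2 = \<chi> g" "g \<in> carrier (G_group n)" for c g
  proof -
    have "c ^ 2 ^ n = (c ^ 2) ^ 2 ^ (n - 1)"
      using n by (simp add: power_Suc[symmetric] flip: power_mult del: power_Suc)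
    then show ?thesis using half that by simp
  qed
  \<comment> \<open>If the principal root is 1, its negative is taken instead; this is what keeps
    \<open>\<psi>\<close> nontrivial at \<open>e\<close>.\<close>
  obtain a where a: "a ^ 2 = \<chi> e" "a \<noteq> 1"
  proof (cases "csqrt (\<chi> e) = 1")
    case True
    then show ?thesis using that[of "- 1"] by (metis power2_csqrt power2_minus one_neq_neg_one)
  next
    case False
    then show ?thesis using that[of "csqrt (\<chi> e)"] by simp
  qed
  define b where "b = csqrt (\<chi> f)"
  have b: "b ^ 2 = \<chi> f" by (simp add: b_def)
  obtain \<psi> where psi: "\<psi> \<in> carrier (dual_group (G_group n))"
    "\<And>x y. x < 2 ^ n \<Longrightarrow> y < 2 ^ n \<Longrightarrow>
      \<psi> (of_nat x / of_nat (2 ^ n), of_nat y / of_nat (2 ^ n)) = a ^ x * b ^ y"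
    using character_of_roots[OF root[OF a(1) ef(1)] root[OF b ef(2)]] by blast
  have "\<chi> = char_square (G_group n) \<psi>"
  proof (rule extensionalityI[of _ "carrier (G_group n)"])
    fix p assume p: "p \<in> carrier (G_group n)"
    then obtain x y where xy: "x < 2 ^ n" "y < 2 ^ n" "p = (of_nat x / of_nat (2 ^ n), of_nat y / of_nat (2 ^ n))"
      by (rule G_group_cases)
    have "\<chi> p = (a ^ 2) ^ x * (b ^ 2) ^ y"
      using character_on_generators[OF chi' n xy(1,2)] xy(3) a(1) b by (simp only: e_def f_def)
    also have "\<dots> = \<psi> p ^ 2"
      unfolding xy(3) psi(2)[OF xy(1,2)] by (simp add: power_mult_distrib mult.commute flip: power_mult)
    finally show "\<chi> p = char_square (G_group n) \<psi> p"
      using p by (simp add: char_square_def)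
  qed (use chi in \<open>auto simp: dual_group_def char_square_def\<close>)
  moreover have "\<psi> e = a" using psi(2)[OF N] by (simp add: e_def)
  then have "\<psi> \<noteq> \<one>\<^bsub>dual_group (G_group n)\<^esub>"
    using a(2) ef(1) by (auto simp: dual_group_def)
  ultimately show ?thesis using that psi(1) by blast
qed

text \<open>A nontrivial \<open>\<psi>\<close> has even order, and the order of its second power is
  half of that.\<close>

lemma ord_char_square_less:
  assumes psi: "\<psi> \<in> carrier (dual_group (G_group n))"
    and nt: "\<psi> \<noteq> \<one>\<^bsub>dual_group (G_group n)\<^esub>"
  shows "group.ord (dual_group (G_group n)) (char_square (G_group n) \<psi>)
    < group.ord (dual_group (G_group n)) \<psi>"
proof -
  interpret G: comm_group "G_group n" by (rule comm_group_G_group)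
  interpret D: comm_group "dual_group (G_group n)" by (rule comm_group_dual_group) (rule G.is_group)
  obtain j where j: "D.ord \<psi> = 2 ^ j"
    using ord_dual_G_group[OF psi] by blast
  then have "2 dvd D.ord \<psi>"
    using D.ord_eq_1[OF psi] nt by (cases j) auto
  moreover have "char_square (G_group n) \<psi> = \<psi> [^]\<^bsub>dual_group (G_group n)\<^esub> (2::nat)"
    by (simp add: char_square_def dual_group_pow[OF G.is_group psi])
  ultimately show ?thesis
    using D.ord_pow[OF psi, of 2] j by simp
qed

theorem theorem2p5:
  fixes n :: nat
  assumes "n \<ge> 2"
  shows "(\<forall>\<chi> \<in> carrier (dual_group (G_group n)). group.ord (dual_group (G_group n)) \<chi> < 2 ^ n \<longrightarrow>
            (\<exists>\<psi> \<in> carrier (dual_group (G_group n)).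
               \<chi> = char_square (G_group n) \<psi> \<and>
               group.ord (dual_group (G_group n)) \<chi> < group.ord (dual_group (G_group n)) \<psi>)) \<and>
         (\<forall>\<chi> \<in> carrier (dual_group (G_group n)). \<forall>\<psi> \<in> carrier (dual_group (G_group n)).
            \<chi> = char_square (G_group n) \<psi> \<longrightarrow>
            (\<forall>M \<in> tree_nodes n.
               (char_sum \<chi> M = of_nat (card M) \<longleftrightarrow>
                  char_sum \<psi> M = of_nat (card M) \<or> char_sum \<psi> M = - of_nat (card M)) \<and>
               (char_sum \<chi> M = - of_nat (card M) \<longleftrightarrow>
                  (\<exists>X \<in> tree_nodes n. is_child n M X \<and> char_sum \<psi> X = - of_nat (card X))) \<and>
               (\<not> (char_sum \<psi> M = of_nat (card M) \<or> char_sum \<psi> M = - of_nat (card M)) \<and>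
                \<not> (\<exists>X \<in> tree_nodes n. is_child n M X \<and> char_sum \<psi> X = - of_nat (card X)) \<longrightarrow>
                  char_sum \<chi> M = 0)))"
proof (intro conjI ballI impI)
  fix \<chi> assume "\<chi> \<in> carrier (dual_group (G_group n))" "group.ord (dual_group (G_group n)) \<chi> < 2 ^ n"
  moreover have "n \<ge> 1" using assms by simp
  ultimately obtain \<psi> where "\<psi> \<in> carrier (dual_group (G_group n))" "\<chi> = char_square (G_group n) \<psi>"
      "\<psi> \<noteq> \<one>\<^bsub>dual_group (G_group n)\<^esub>"
    using exists_nontrivial_char_square_root[of n \<chi>] by blast
  then show "\<exists>\<psi> \<in> carrier (dual_group (G_group n)). \<chi> = char_square (G_group n) \<psi> \<and>
      group.ord (dual_group (G_group n)) \<chi> < group.ord (dual_group (G_group n)) \<psi>"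
    using ord_char_square_less by blast
next
  fix \<chi> \<psi> M
  assume "\<chi> \<in> carrier (dual_group (G_group n))" "\<psi> \<in> carrier (dual_group (G_group n))"
    and sq: "\<chi> = char_square (G_group n) \<psi>" and "M \<in> tree_nodes n"
  have n: "n \<ge> 1" using assms by simp
  have chi: "\<chi> \<in> hom (G_group n) complex_mult_group" and psi: "\<psi> \<in> hom (G_group n) complex_mult_group"
    using \<open>\<chi> \<in> _\<close> \<open>\<psi> \<in> _\<close> by (simp_all add: dual_group_def)
  obtain g where g: "g \<in> carrier (G_group n)" and M: "M = {g [^]\<^bsub>G_group n\<^esub> k | k::nat. odd k}"
    using \<open>M \<in> tree_nodes n\<close> in_tree_nodes_iff[OF n] by blast
  \<comment> \<open>All three claims now concern one number: \<open>\<psi> g ^ 2\<close> is 1 iff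
    \<open>\<psi> g\<close> is 1 or -1, and it is -1 iff \<open>M\<close> has a parent of the
    required kind.\<close>
  have val: "\<chi> g = \<psi> g ^ 2" using g by (simp add: sq char_square_def)
  note chi_sum = node_char_sum[OF chi g M]
  note psi_sum = node_char_sum[OF psi g M]
  note child = power2_eq_minus_one_iff_child[OF n g psi M]
  show pos: "char_sum \<chi> M = of_nat (card M) \<longleftrightarrow>
      char_sum \<psi> M = of_nat (card M) \<or> char_sum \<psi> M = - of_nat (card M)"
    by (simp only: chi_sum psi_sum val power2_eq_1_iff)
  show neg: "char_sum \<chi> M = - of_nat (card M) \<longleftrightarrow>
      (\<exists>X \<in> tree_nodes n. is_child n M X \<and> char_sum \<psi> X = - of_nat (card X))"
    by (simp only: chi_sum val child)
  show "char_sum \<chi> M = 0"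
    if "\<not> (char_sum \<psi> M = of_nat (card M) \<or> char_sum \<psi> M = - of_nat (card M)) \<and>
      \<not> (\<exists>X \<in> tree_nodes n. is_child n M X \<and> char_sum \<psi> X = - of_nat (card X))"
    \<comment> \<open>By the two equivalences the assumption says that the sum is neither
      \<open>card M\<close> nor \<open>- card M\<close>, which leaves 0.\<close>
    using that chi_sum by (simp only: pos[symmetric] neg[symmetric]) blast
qed

end
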